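(* Let $m\ge 2$ and let $(d_1,\dots,d_m)$ and $(c_0,\dots,c_m)$ be sequences of (not necessarily distinct) natural numbers such that $\frac{d_i}{c_{i-1}}=z$ for all $1\le i\le m$, for some rational $z$ with $0<z<1$. Then there exists a non-disjoint $(c_0\cdots c_m,\,m,\,c_0\cdots c_m z,\,c_0\cdots c_m z^2)$-PSEDF in $\mathbb{Z}_{c_0\cdots c_m}$.
   Context: For subsets $A,B$ of an additively written group $G$, $\Delta(A,B)$ denotes the multiset $\{a-b:a\in A,b\in B\}$ (one entry per pair). For $\lambda\in\mathbb{N}$, $\lambda G$ is the multiset containing every element of $G$ exactly $\lambda$ times. For a group $G$ of order $v$ and $m>1$, a family of $k$-subsets $\{A_1,\dots,A_m\}$ of $G$ is a non-disjoint $(v,m,k,\lambda)$-PSEDF if $\Delta(A_i,A_j)=\lambda G$ for all $1\le i\ne j\le m$. *)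

theory Defs
  imports Complex_Main "HOL-Algebra.Elementary_Groups" "HOL-Library.Multiset"
begin

text \<open>
  Groups are those of HOL-Algebra, written multiplicatively, so the difference \<open>a - b\<close> is
  \<open>a \<otimes> inv b\<close>. Since \<^const>\<open>mset_set\<close> maps infinite sets to the empty multiset, the next two
  definitions are meaningful for finite sets and finite groups only.
\<close>

definition diff_mset :: "('a, 'b) monoid_scheme \<Rightarrow> 'a set \<Rightarrow> 'a set \<Rightarrow> 'a multiset" where
  "diff_mset G A B = image_mset (\<lambda>(a, b). a \<otimes>\<^bsub>G\<^esub> inv\<^bsub>G\<^esub> b) (mset_set (A \<times> B))"

definition group_mset :: "nat \<Rightarrow> ('a, 'b) monoid_scheme \<Rightarrow> 'a multiset" where
  "group_mset l G = repeat_mset l (mset_set (carrier G))"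

text \<open>
  The family is indexed by \<open>1, \<dots>, m\<close>; values of \<open>A\<close> at other indices are irrelevant.
\<close>

definition nondisjoint_PSEDF ::
  "('a, 'b) monoid_scheme \<Rightarrow> nat \<Rightarrow> nat \<Rightarrow> nat \<Rightarrow> nat \<Rightarrow> (nat \<Rightarrow> 'a set) \<Rightarrow> bool" where
  "nondisjoint_PSEDF G v m k l A \<longleftrightarrow>
     group G \<and> finite (carrier G) \<and> order G = v \<and> m > 1 \<and>
     (\<forall>i\<in>{1..m}. A i \<subseteq> carrier G \<and> card (A i) = k) \<and>
     (\<forall>i\<in>{1..m}. \<forall>j\<in>{1..m}. i \<noteq> j \<longrightarrow> diff_mset G (A i) (A j) = group_mset l G)"

end

theory Submission
  imports Defs
begin

text \<open>
  Write \<open>x\<close> in mixed radix with bases \<open>c\<^sub>0, c\<^sub>1, \<dots>\<close> (least significant first) and let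
  \<open>A\<^sub>i\<close> consist of the \<open>x\<close> whose digit to base \<open>c\<^sub>i\<^sub>-\<^sub>1\<close> is less than \<open>d\<^sub>i\<close>, a set of density \<open>z\<close>.
  For \<open>i < j\<close>, every translate of \<open>A\<^sub>i\<close> is a union of classes modulo \<open>c\<^sub>0\<cdots>c\<^sub>i\<^sub>-\<^sub>1\<close>, and \<open>A\<^sub>j\<close>
  meets each such class with density exactly \<open>z\<close>. So \<open>A\<^sub>j\<close> meets every translate of \<open>A\<^sub>i\<close>
  with density \<open>z\<^sup>2\<close>.
\<close>

text \<open>The map \<open>x \<mapsto> (x mod P, x div P)\<close> is a bijection from
  \<open>{0..<P * n}\<close> onto \<open>{0..<P} \<times> {0..<n}\<close>, so conditions on the low
  and the high part of \<open>x\<close> are independent. This is the source of every product of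
  densities below.\<close>

lemma card_mod_div:
  fixes P n :: int
  assumes "P > 0"
  shows "card {x \<in> {0..<P * n}. p (x mod P) \<and> q (x div P)} =
         card {s \<in> {0..<P}. p s} * card {u \<in> {0..<n}. q u}"
proof -
  let ?X = "{x \<in> {0..<P * n}. p (x mod P) \<and> q (x div P)}"
  let ?Y = "{s \<in> {0..<P}. p s} \<times> {u \<in> {0..<n}. q u}"
  have upper: "s + P * u < P * n" if "s < P" "u < n" for s u
  proof -
    have "P * (u + 1) \<le> P * n" using that assms by (intro mult_left_mono) auto
    then show ?thesis using that by (simp add: algebra_simps)
  qed
  have quotient: "x div P < n" if "x < P * n" for x
  proof (rule ccontr)
    assume "\<not> x div P < n"
    then have "P * n \<le> P * (x div P)" using assms by (intro mult_left_mono) auto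
    also have "\<dots> \<le> x" using assms mult_div_mod_eq[of P x] pos_mod_sign[of P x] by linarith
    finally show False using that by simp
  qed
  have "bij_betw (\<lambda>x. (x mod P, x div P)) ?X ?Y"
    using assms upper quotient
    by (intro bij_betw_byWitness[where f' = "\<lambda>(s, u). s + P * u"])
       (auto simp: pos_imp_zdiv_nonneg_iff)
  then show ?thesis
    by (simp add: bij_betw_same_card card_cartesian_product)
qed

text \<open>Translation by \<open>h\<close> permutes the residues modulo \<open>P\<close>. This is
  what makes the intersection sizes independent of the translate.\<close>

lemma card_translate_mod:
  fixes P h :: int
  assumes "P > 0"
  shows "card {s \<in> {0..<P}. p ((s + h) mod P)} = card {s \<in> {0..<P}. p s}"
proof -
  have "bij_betw (\<lambda>s. (s + h) mod P) {s \<in> {0..<P}. p ((s + h) mod P)} {s \<in> {0..<P}. p s}"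
    using assms
    by (intro bij_betw_byWitness[where f' = "\<lambda>s. (s - h) mod P"]) (auto simp: mod_simps)
  then show ?thesis by (rule bij_betw_same_card)
qed

text \<open>Here \<open>Q\<close> is the place value of the digit and \<open>b\<close> its
  base.\<close>

definition digit_set :: "int \<Rightarrow> int \<Rightarrow> int \<Rightarrow> int \<Rightarrow> int set" where
  "digit_set N Q b d = {x \<in> {0..<N}. x div Q mod b < d}"

text \<open>With \<open>N = Q * (b * t)\<close>, splitting at \<open>Q\<close> frees the lower
  digits (\<open>Q\<close> choices), and splitting the quotient at \<open>b\<close> isolates the
  digit (\<open>d\<close> choices) from the higher ones (\<open>t\<close> choices).\<close>

lemma card_digit_set:
  assumes "N > 0" "Q > 0" "b > 0" "0 \<le> d" "d \<le> b" "Q * b dvd N"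
  shows "of_nat (card (digit_set N Q b d)) = (of_int (N * d) / of_int b :: 'a::field_char_0)"
proof -
  obtain t where t: "N = Q * (b * t)" using assms(6) unfolding dvd_def mult.assoc ..
  have "t > 0" using assms(1-3) t by (simp add: zero_less_mult_iff)
  have "{s. s \<in> {0..<b} \<and> s < d} = {0..<d}" using assms by auto
  then have "card {x \<in> {0..<b * t}. x mod b < d} = nat d * nat t"
    using card_mod_div[OF \<open>b > 0\<close>, of t "\<lambda>s. s < d" "\<lambda>_. True"]
    by (simp del: atLeastLessThan_iff)
  then have "card (digit_set N Q b d) = nat Q * (nat d * nat t)"
    using card_mod_div[OF \<open>Q > 0\<close>, of "b * t" "\<lambda>_. True" "\<lambda>u. u mod b < d"]
    by (simp add: digit_set_def t del: atLeastLessThan_iff)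
  then show ?thesis using assms \<open>t > 0\<close> by (simp add: t)
qed

text \<open>Let \<open>P = Q * b\<close>. Since \<open>P\<close> divides \<open>Q'\<close>, the
  lower digit depends only on \<open>x mod P\<close> and the upper one only on
  \<open>x div P\<close>. Adding \<open>h\<close> merely translates the residue modulo
  \<open>P\<close>, so the two conditions are independent and the densities multiply.\<close>

lemma card_digit_set_translate:
  fixes h :: int
  assumes "N > 0" "Q > 0" "b > 0" "0 \<le> d" "d \<le> b"
    and "Q' > 0" "b' > 0" "0 \<le> d'" "d' \<le> b'" "Q * b dvd Q'" "Q' * b' dvd N"
  shows "of_nat (card {y \<in> digit_set N Q' b' d'. (y + h) mod N \<in> digit_set N Q b d}) =
         (of_int N * (of_int d / of_int b) * (of_int d' / of_int b') :: 'a::field_char_0)"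
proof -
  define P where "P = Q * b"
  obtain r where r: "Q' = P * r" using assms by (auto simp: P_def)
  obtain t where t: "N = Q' * b' * t" using assms(11) ..
  define n where "n = r * b' * t"
  have n: "N = P * n" and n': "r * b' dvd n" by (simp_all add: t r n_def mult.assoc)
  have "P > 0" using assms by (simp add: P_def)
  have "r > 0" "n > 0" using \<open>P > 0\<close> assms r n by (auto simp: zero_less_mult_iff)
  have digit: "x div Q mod b = x mod P div Q" for x
    using assms by (simp add: P_def zmod_zmult2_eq)
  \<comment> \<open>As \<open>P\<close> divides \<open>N\<close>, the reduction modulo
    \<open>N\<close> is invisible modulo \<open>P\<close>; as \<open>Q' = P * r\<close>, dividing by
    \<open>Q'\<close> is dividing by \<open>P\<close> and then by \<open>r\<close>.\<close>
  have "{y \<in> digit_set N Q' b' d'. (y + h) mod N \<in> digit_set N Q b d} =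
     {x \<in> {0..<P * n}. (x mod P + h) mod P div Q < d \<and> x div P div r mod b' < d'}"
    using assms(1) \<open>P > 0\<close> \<open>r > 0\<close>
    by (simp add: digit_set_def digit r n zdiv_zmult2_eq mod_mod_cancel mod_simps conj_commute conj_left_commute)
  then have "card {y \<in> digit_set N Q' b' d'. (y + h) mod N \<in> digit_set N Q b d} =
     card {s \<in> {0..<P}. (s + h) mod P div Q < d} * card (digit_set n r b' d')"
    using card_mod_div[OF \<open>P > 0\<close>, of n "\<lambda>s. (s + h) mod P div Q < d" "\<lambda>u. u div r mod b' < d'"]
    by (simp add: digit_set_def)
  also have "{s \<in> {0..<P}. s div Q < d} = digit_set P Q b d"
    by (auto simp: digit_set_def digit)
  then have "card {s \<in> {0..<P}. (s + h) mod P div Q < d} = card (digit_set P Q b d)"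
    using card_translate_mod[OF \<open>P > 0\<close>, of "\<lambda>s. s div Q < d" h] by simp
  finally show ?thesis
    using assms \<open>P > 0\<close> \<open>r > 0\<close> \<open>n > 0\<close> n'
    by (simp add: card_digit_set P_def n)
qed

lemma diff_mset_integer_mod_group:
  fixes N :: nat
  assumes "N > 0" "A \<subseteq> {0..<int N}" "B \<subseteq> {0..<int N}"
  shows "diff_mset (integer_mod_group N) A B =
         image_mset (\<lambda>(a, b). (a - b) mod int N) (mset_set (A \<times> B))"
  unfolding diff_mset_def
proof (rule image_mset_cong)
  fix x assume "x \<in># mset_set (A \<times> B)"
  moreover have "finite (A \<times> B)"
    using assms finite_subset by blast
  ultimately obtain a b where "x = (a, b)" "a \<in> A" "b \<in> B" by auto
  then show "(case x of (a, b) \<Rightarrow> a \<otimes>\<^bsub>integer_mod_group N\<^esub> inv\<^bsub>integer_mod_group N\<^esub> b) =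
      (case x of (a, b) \<Rightarrow> (a - b) mod int N)"
    using assms by (auto simp: carrier_integer_mod_group mod_simps)
qed

text \<open>The equation \<open>a - b = g\<close> can be solved for \<open>a\<close> or for
  \<open>b\<close>. Both forms are recorded because \<open>card_digit_set_translate\<close> tests
  the translated point against the set with the lower digit, which may be either \<open>A\<close> or
  \<open>B\<close>.\<close>

lemma count_diff_mset_integer_mod_group:
  fixes N :: nat
  assumes "N > 0" "A \<subseteq> {0..<int N}" "B \<subseteq> {0..<int N}" "g \<in> {0..<int N}"
  shows "count (diff_mset (integer_mod_group N) A B) g = card {b \<in> B. (b + g) mod int N \<in> A}"
    and "count (diff_mset (integer_mod_group N) A B) g = card {a \<in> A. (a - g) mod int N \<in> B}"
proof -
  have fin: "finite (A \<times> B)"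
    using assms finite_subset by blast
  define S where "S = {(a, b). (a - b) mod int N = g} \<inter> A \<times> B"
  have solve1: "(b + g) mod int N = a"
    and solve2: "(a - g) mod int N = b" if "(a, b) \<in> S" for a b
    using that assms by (auto simp: S_def mod_simps)
  have "count (diff_mset (integer_mod_group N) A B) g = card S"
    using fin assms
    by (auto simp: diff_mset_integer_mod_group count_image_mset S_def intro!: arg_cong[where f=card])
  moreover have "bij_betw snd S {b \<in> B. (b + g) mod int N \<in> A}"
    using assms solve1
    by (intro bij_betw_byWitness[where f' = "\<lambda>b. ((b + g) mod int N, b)"])
       (force simp: S_def mod_simps)+
  moreover have "bij_betw fst S {a \<in> A. (a - g) mod int N \<in> B}"
    using assms solve2
    by (intro bij_betw_byWitness[where f' = "\<lambda>a. (a, (a - g) mod int N)"])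
       (force simp: S_def mod_simps)+
  ultimately show "count (diff_mset (integer_mod_group N) A B) g = card {b \<in> B. (b + g) mod int N \<in> A}"
    and "count (diff_mset (integer_mod_group N) A B) g = card {a \<in> A. (a - g) mod int N \<in> B}"
    by (auto dest: bij_betw_same_card)
qed

theorem theorem3p4:
  fixes m :: nat and d c :: "nat \<Rightarrow> nat" and z :: rat
  assumes "m \<ge> 2"
    and "\<And>i. i \<in> {0..m} \<Longrightarrow> c i > 0"
    and "\<And>i. i \<in> {1..m} \<Longrightarrow> of_nat (d i) / of_nat (c (i - 1)) = z"
    and "0 < z" and "z < 1"
  shows "\<exists>(k::nat) (l::nat) A.
           of_nat k = of_nat (\<Prod>i=0..m. c i) * z \<and>
           of_nat l = of_nat (\<Prod>i=0..m. c i) * z\<^sup>2 \<and>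
           nondisjoint_PSEDF (integer_mod_group (\<Prod>i=0..m. c i)) (\<Prod>i=0..m. c i) m k l A"
proof -
  define N where "N = (\<Prod>i=0..m. c i)"
  \<comment> \<open>\<open>Q i\<close> is the place value of the digit to base \<open>c i\<close>.
    Digits are numbered from 0 and sets from 1, hence the index \<open>i - 1\<close> in
    \<open>A i\<close>.\<close>
  define Q where "Q i = (\<Prod>j<i. c j)" for i
  define A where "A i = digit_set (int N) (int (Q (i - 1))) (int (c (i - 1))) (int (d i))" for i
  have Npos: "N > 0" using assms(2) by (auto simp: N_def)
  have Q_dvd: "Q i dvd Q j" if "i \<le> j" for i j
    unfolding Q_def using that by (intro prod_dvd_prod_subset) auto
  have Q_mult: "Q (i - 1) * c (i - 1) = Q i" if "i \<in> {1..m}" for i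
    using that by (cases i) (auto simp: Q_def)
  have N_dvd: "Q i dvd N" if "i \<le> m" for i
    unfolding Q_def N_def using that by (intro prod_dvd_prod_subset) auto
  have Qpos: "Q i > 0" if "i \<le> m" for i
    using N_dvd[OF that] Npos by (auto intro: dvd_pos_nat)
  have cpos: "c (i - 1) > 0" if "i \<in> {1..m}" for i
    using assms(2)[of "i - 1"] that by auto
  have d_le: "d i \<le> c (i - 1)" if "i \<in> {1..m}" for i
  proof -
    have "(of_nat (d i) :: rat) < of_nat (c (i - 1))"
      using assms(3)[OF that] assms(5) cpos[OF that] by (auto simp: field_simps)
    then show ?thesis by simp
  qed
  have sub: "A i \<subseteq> {0..<int N}" for i by (auto simp: A_def digit_set_def)
  have card_A: "of_nat (card (A i)) = of_nat N * z" if "i \<in> {1..m}" for i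
  proof -
    have "int (Q (i - 1)) * int (c (i - 1)) dvd int N"
      using Q_mult[OF that] N_dvd[of i] that by (simp flip: of_nat_mult)
    then show ?thesis
      unfolding A_def assms(3)[OF that, symmetric]
      using that Npos Qpos[of "i - 1"] cpos[OF that] d_le[OF that]
      by (subst card_digit_set) auto
  qed
  have meet: "of_nat (card {y \<in> A j. (y + h) mod int N \<in> A i}) = of_nat N * z\<^sup>2"
    if "i \<in> {1..m}" "j \<in> {1..m}" "i < j" for i j h
  proof -
    have "int (Q (j - 1)) * int (c (j - 1)) dvd int N"
      using Q_mult[OF that(2)] N_dvd[of j] that(2) by (simp flip: of_nat_mult)
    \<comment> \<open>This is where \<open>i < j\<close> enters: the left side is
      \<open>Q i\<close>, and \<open>i \<le> j - 1\<close>, so the digit of \<open>A i\<close> lies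
      strictly below that of \<open>A j\<close>.\<close>
    moreover have "int (Q (i - 1)) * int (c (i - 1)) dvd int (Q (j - 1))"
      using Q_mult[OF that(1)] Q_dvd[of i "j - 1"] \<open>i < j\<close> by (simp flip: of_nat_mult)
    moreover have "i - 1 \<le> m" "j - 1 \<le> m" using that by auto
    ultimately show ?thesis
      unfolding A_def
      using Npos Qpos[of "i - 1"] Qpos[of "j - 1"] cpos[OF that(1)] cpos[OF that(2)]
        d_le[OF that(1)] d_le[OF that(2)] assms(3)[OF that(1)] assms(3)[OF that(2)]
      by (subst card_digit_set_translate) (simp_all add: power2_eq_square)
  qed
  \<comment> \<open>Taking \<open>k\<close> and \<open>l\<close> as cardinalities of sample sets
    makes them natural numbers at once, so the integrality of \<open>N * z\<close> and
    \<open>N * z\<^sup>2\<close> comes for free. The shift 0 puts \<open>l\<close> in the form of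
    \<open>meet\<close>.\<close>
  define k where "k = card (A 1)"
  define l where "l = card {y \<in> A 2. (y + 0) mod int N \<in> A 1}"
  have k: "of_nat k = of_nat N * z" unfolding k_def using assms(1) by (intro card_A) auto
  have l: "of_nat l = of_nat N * z\<^sup>2" unfolding l_def using assms(1) by (intro meet) auto
  have diff: "diff_mset (integer_mod_group N) (A i) (A j) = group_mset l (integer_mod_group N)"
    if ij: "i \<in> {1..m}" "j \<in> {1..m}" "i \<noteq> j" for i j
  proof (rule multiset_eqI)
    fix g
    show "count (diff_mset (integer_mod_group N) (A i) (A j)) g =
          count (group_mset l (integer_mod_group N)) g"
    proof (cases "g \<in> {0..<int N}")
      case True
      have "(of_nat (count (diff_mset (integer_mod_group N) (A i) (A j)) g) :: rat) = of_nat l"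
      proof (cases "i < j")
        case True
        then show ?thesis
          using count_diff_mset_integer_mod_group(1)[OF Npos sub sub \<open>g \<in> _\<close>] meet[OF ij(1,2), of g] l
          by simp
      next
        \<comment> \<open>Now \<open>j < i\<close>, so \<open>A j\<close> has the lower digit: the
          points of \<open>A i\<close> are counted instead, translated by
          \<open>- g\<close>.\<close>
        case False
        then show ?thesis
          using count_diff_mset_integer_mod_group(2)[OF Npos sub sub \<open>g \<in> _\<close>]
            meet[OF ij(2,1), of "- g"] l ij(3)
          by simp
      qed
      then show ?thesis
        using True Npos by (simp add: group_mset_def carrier_integer_mod_group)
    next
      \<comment> \<open>The group lives on the type \<open>int\<close>, so equality of multisets
        also has to be checked outside the carrier, where both counts are 0.\<close>
      case False
      have "g \<notin># diff_mset (integer_mod_group N) (A i) (A j)"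
        using False Npos sub by (auto simp: diff_mset_integer_mod_group)
      then have "count (diff_mset (integer_mod_group N) (A i) (A j)) g = 0"
        by (simp add: not_in_iff)
      then show ?thesis
        using False Npos by (auto simp: group_mset_def carrier_integer_mod_group)
    qed
  qed
  have "card (A i) = k" if "i \<in> {1..m}" for i
    using card_A[OF that] k by (metis of_nat_eq_iff)
  then have "nondisjoint_PSEDF (integer_mod_group N) N m k l A"
    using Npos assms(1) sub diff
    by (auto simp: nondisjoint_PSEDF_def order_def carrier_integer_mod_group)
  then show ?thesis using k l unfolding N_def by blast
qed

end
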